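(* (Bifurcation Lemma.) Let $(G,i)$ be a rooted graph on $n$ vertices and let $A \in \mathcal{S}(G)$ be a matrix with $i$-SNIP. Then there is an $\epsilon > 0$ such that for every $n\times n$ real symmetric matrix $M$ with $\|M - A\| < \epsilon$, there exists a matrix $A' \in \mathcal{S}(G)$ with $i$-SNIP such that $M$ and $A'$ have the same $i$-nullity pair.
   Context: All graphs are finite and simple. For a graph $G$ on $n$ vertices labeled $1,\dots,n$, $\mathcal{S}(G)$ denotes the set of $n\times n$ real symmetric matrices whose off-diagonal $(j,k)$-entry is nonzero if and only if $\{j,k\}$ is an edge of $G$ (diagonal entries arbitrary). For a matrix $A$ and index $i$, $A(i)$ is the principal submatrix obtained by deleting row $i$ and column $i$, and $(AX)(i,:]$ denotes the matrix $AX$ with row $i$ deleted. $\operatorname{null}$ denotes the dimension of the kernel. The $i$-nullity pair of a symmetric matrix $A$ is $(\operatorname{null}(A),\operatorname{null}(A(i)))$. $\circ$ is the entrywise product. A real symmetric $n\times n$ matrix $A$ has the $i$-strong nullity interlacing property ($i$-SNIP) if the only real symmetric matrix $X$ satisfying $A\circ X = O$, $I\circ X = O$ and $(AX)(i,:] = O$ is $X = O$. A rooted graph $(G,i)$ is a graph $G$ with a designated vertex $i$. $\|\cdot\|$ is any fixed norm on $n\times n$ matrices. *)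

theory Defs
  imports "HOL-Analysis.Analysis"
begin

text \<open>
  The \<open>n\<close> vertices of a graph are the elements of a finite type \<open>'n\<close> with \<open>n = CARD('n)\<close>;
  a graph is given by its set of edges, and \<open>n \<times> n\<close> matrices have type \<open>real^'n^'n\<close>.
\<close>

definition simple_graph :: "'n set set \<Rightarrow> bool" where
  "simple_graph E \<longleftrightarrow> (\<forall>e\<in>E. card e = 2)"

definition symmetric_mat :: "real^'n^'n \<Rightarrow> bool" where
  "symmetric_mat A \<longleftrightarrow> transpose A = A"

definition graph_matrices :: "'n set set \<Rightarrow> (real^'n^'n) set" where
  "graph_matrices E =
     {A. symmetric_mat A \<and> (\<forall>j k. j \<noteq> k \<longrightarrow> (A $ j $ k \<noteq> 0 \<longleftrightarrow> {j, k} \<in> E))}"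

definition nullity :: "real^'n^'n \<Rightarrow> nat" where
  "nullity A = dim {x. A *v x = 0}"

text \<open>
  The principal submatrix \<open>A(i)\<close> has the index set \<open>- {i}\<close>, which is not a type. A vector indexed
  by \<open>- {i}\<close> is represented by the vector over \<open>'n\<close> that extends it by \<open>0\<close> at \<open>i\<close>; under this
  linear identification the following set is the kernel of \<open>A(i)\<close>. The lemma
  \<open>nullity_delete_eq_nullity_submatrix\<close> below confirms that \<open>nullity_delete i A\<close> is the
  nullity of \<open>A(i)\<close> for any re-indexing of \<open>A(i)\<close> by a type.
\<close>

definition kernel_delete :: "'n \<Rightarrow> real^'n^'n \<Rightarrow> (real^'n) set" where
  "kernel_delete i A =
     {x. x $ i = 0 \<and> (\<forall>j\<in>- {i}. (\<Sum>k\<in>- {i}. A $ j $ k * x $ k) = 0)}"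

definition nullity_delete :: "'n \<Rightarrow> real^'n^'n \<Rightarrow> nat" where
  "nullity_delete i A = dim (kernel_delete i A)"

lemma nullity_delete_eq_nullity_submatrix:
  fixes A :: "real^'n^'n" and f :: "'m::finite \<Rightarrow> 'n" and i :: 'n
  assumes "bij_betw f UNIV (- {i})"
  shows "nullity_delete i A = nullity (\<chi> a b. A $ f a $ f b)"
proof -
  let ?B = "\<chi> a b. A $ f a $ f b"
  let ?r = "\<lambda>x::real^'n. \<chi> a. x $ f a"
  let ?U = "{x::real^'n. x $ i = 0}"
  have rng: "range f = - {i}" and inj: "inj f"
    using assms by (auto simp: bij_betw_def)
  have lin: "linear ?r"
    by (rule linearI) (auto simp: vec_eq_iff)
  have sub: "subspace ?U"
    by (auto simp: subspace_def)
  have span: "span (kernel_delete i A) \<subseteq> ?U"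
    by (rule span_minimal[OF _ sub]) (auto simp: kernel_delete_def)
  have inj_r: "inj_on ?r ?U"
  proof (rule inj_onI)
    fix x y assume xy: "x \<in> ?U" "y \<in> ?U" "?r x = ?r y"
    have "x $ j = y $ j" for j
    proof (cases "j = i")
      case False
      then obtain a where "j = f a" using rng by blast
      then show ?thesis using xy(3) by (simp add: vec_eq_iff)
    qed (use xy in auto)
    then show "x = y" by (simp add: vec_eq_iff)
  qed
  have sum: "(\<Sum>k\<in>- {i}. A $ j $ k * x $ k) = (\<Sum>b\<in>UNIV. A $ j $ f b * x $ f b)" for j x
    by (rule sum.reindex_bij_betw[OF assms, symmetric])
  have ker: "kernel_delete i A = {x \<in> ?U. ?B *v ?r x = 0}"
    unfolding kernel_delete_def
    by (simp only: sum) (auto simp: rng[symmetric] matrix_vector_mult_def vec_eq_iff)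
  have img: "?r ` kernel_delete i A = {y. ?B *v y = 0}"
  proof (intro equalityI subsetI)
    fix y :: "real^'m" assume y: "y \<in> {y. ?B *v y = 0}"
    define x :: "real^'n" where "x = (\<chi> j. if j = i then 0 else y $ inv f j)"
    have "f a \<noteq> i" for a using rng by auto
    then have rx: "?r x = y" using inj by (simp add: x_def vec_eq_iff)
    have "x $ i = 0" by (simp add: x_def)
    with rx y have "x \<in> kernel_delete i A" unfolding ker by simp
    then show "y \<in> ?r ` kernel_delete i A" using rx by (metis image_eqI)
  qed (auto simp: ker)
  have "dim (?r ` kernel_delete i A) = dim (kernel_delete i A)"
    by (rule dim_image_eq[OF lin]) (rule inj_on_subset[OF inj_r span])
  then show ?thesis
    unfolding nullity_delete_def nullity_def img by simp
qed

definition nullity_pair :: "'n \<Rightarrow> real^'n^'n \<Rightarrow> nat \<times> nat" where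
  "nullity_pair i A = (nullity A, nullity_delete i A)"

definition entrywise_prod :: "real^'n^'n \<Rightarrow> real^'n^'n \<Rightarrow> real^'n^'n" where
  "entrywise_prod A B = (\<chi> j k. A $ j $ k * B $ j $ k)"

definition SNIP :: "'n \<Rightarrow> real^'n^'n \<Rightarrow> bool" where
  "SNIP i A \<longleftrightarrow> symmetric_mat A \<and>
     (\<forall>X. symmetric_mat X \<and> entrywise_prod A X = 0 \<and> entrywise_prod (mat 1) X = 0 \<and>
          (\<forall>j k. j \<noteq> i \<longrightarrow> (A ** X) $ j $ k = 0)
        \<longrightarrow> X = 0)"

definition is_norm :: "('a::real_vector \<Rightarrow> real) \<Rightarrow> bool" where
  "is_norm N \<longleftrightarrow>
     (\<forall>x. 0 \<le> N x) \<and> (\<forall>x. N x = 0 \<longleftrightarrow> x = 0) \<and>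
     (\<forall>c x. N (c *\<^sub>R x) = \<bar>c\<bar> * N x) \<and> (\<forall>x y. N (x + y) \<le> N x + N y)"

end

theory Submission
  imports Defs
begin

text \<open>
  Congruence by an invertible \<open>C\<close> whose \<open>i\<close>-th row is that of the identity preserves the
  \<open>i\<close>-nullity pair. Consider \<open>(C, B) \<mapsto> C\<^sup>T B C\<close> for such \<open>C\<close> near the identity and symmetric \<open>B\<close>
  near \<open>A\<close> that vanish at the non-edges. The symmetric matrices orthogonal to the range of the
  derivative at \<open>(I, A)\<close> are those that the \<open>i\<close>-SNIP requires to vanish, so the derivative
  maps onto the symmetric matrices and the map covers a neighbourhood of \<open>A\<close> among them. Being
  injectivity of a linear map that depends continuously on the matrix, the \<open>i\<close>-SNIP passes from
  \<open>A\<close> to every such \<open>B\<close> near \<open>A\<close>.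
\<close>

subsection \<open>Euclidean spaces\<close>

lemma is_norm_continuous_on:
  fixes N :: "'a::euclidean_space \<Rightarrow> real"
  assumes "is_norm N"
  shows "continuous_on UNIV N"
proof (rule convex_on_continuous[OF open_UNIV])
  have tri: "N (x + y) \<le> N x + N y" and scale: "N (a *\<^sub>R x) = \<bar>a\<bar> * N x" for a x y
    using assms by (auto simp: is_norm_def)
  show "convex_on UNIV N"
  proof (rule convex_onI)
    fix t :: real and x y :: 'a
    assume "0 < t" "t < 1"
    then show "N ((1 - t) *\<^sub>R x + t *\<^sub>R y) \<le> (1 - t) * N x + t * N y"
      using tri[of "(1 - t) *\<^sub>R x" "t *\<^sub>R y"] by (simp add: scale)
  qed simp
qed

lemma is_norm_ge_scaled_norm:
  fixes N :: "'a::euclidean_space \<Rightarrow> real"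
  assumes "is_norm N"
  obtains c where "c > 0" "\<And>x. c * norm x \<le> N x"
proof -
  have nonneg: "0 \<le> N x" and zero: "N x = 0 \<longleftrightarrow> x = 0"
    and scale: "N (a *\<^sub>R x) = \<bar>a\<bar> * N x" for a x
    using assms by (auto simp: is_norm_def)
  have "continuous_on (sphere 0 1) N"
    using is_norm_continuous_on[OF assms] continuous_on_subset by blast
  then obtain u where u: "u \<in> sphere 0 1" "\<And>x. x \<in> sphere 0 1 \<Longrightarrow> N u \<le> N x"
    using continuous_attains_inf[OF compact_sphere, of 0 1 N] by auto
  show ?thesis
  proof
    show "N u > 0"
      using u(1) nonneg[of u] zero[of u] by (cases "u = 0") auto
    show "N u * norm x \<le> N x" for x
    proof (cases "x = 0")
      case False
      then have "N u \<le> N (inverse (norm x) *\<^sub>R x)"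
        by (intro u(2)) simp
      then show ?thesis
        using False by (simp add: scale field_simps)
    qed (simp add: nonneg)
  qed
qed

lemma eventually_nhds_is_norm:
  fixes N :: "'a::euclidean_space \<Rightarrow> real"
  assumes "is_norm N"
  shows "(\<forall>\<^sub>F x in nhds a. P x) \<longleftrightarrow> (\<exists>\<epsilon>>0. \<forall>x. N (x - a) < \<epsilon> \<longrightarrow> P x)"
proof
  obtain c where c: "c > 0" "\<And>x. c * norm x \<le> N x"
    using is_norm_ge_scaled_norm[OF assms] by blast
  assume "\<forall>\<^sub>F x in nhds a. P x"
  then obtain d where d: "d > 0" "\<And>x. dist x a < d \<Longrightarrow> P x"
    by (auto simp: eventually_nhds_metric)
  have "P x" if "N (x - a) < c * d" for x
  proof (rule d(2))
    have "c * dist x a < c * d"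
      using c(2)[of "x - a"] that by (simp add: dist_norm)
    then show "dist x a < d"
      using c(1) by simp
  qed
  then show "\<exists>\<epsilon>>0. \<forall>x. N (x - a) < \<epsilon> \<longrightarrow> P x"
    using c(1) d(1) by (intro exI[of _ "c * d"]) simp
next
  assume "\<exists>\<epsilon>>0. \<forall>x. N (x - a) < \<epsilon> \<longrightarrow> P x"
  then obtain \<epsilon> where \<epsilon>: "\<epsilon> > 0" "\<And>x. N (x - a) < \<epsilon> \<Longrightarrow> P x"
    by blast
  have "isCont N (a - a)"
    using is_norm_continuous_on[OF assms] by (simp add: continuous_on_eq_continuous_at)
  then have "((\<lambda>x. N (x - a)) \<longlongrightarrow> N (a - a)) (nhds a)"
    by (rule isCont_tendsto_compose) (intro tendsto_intros filterlim_ident)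
  moreover have "N (a - a) < \<epsilon>"
    using assms \<epsilon>(1) unfolding is_norm_def by (metis diff_self)
  ultimately have "\<forall>\<^sub>F x in nhds a. N (x - a) < \<epsilon>"
    by (rule order_tendstoD)
  then show "\<forall>\<^sub>F x in nhds a. P x"
    by (rule eventually_mono) (rule \<epsilon>(2))
qed

lemma subspace_eqI_orthogonal:
  fixes S V :: "'a::euclidean_space set"
  assumes "subspace S" "subspace V" "S \<subseteq> V"
    and "\<And>x. x \<in> V \<Longrightarrow> (\<And>y. y \<in> S \<Longrightarrow> orthogonal x y) \<Longrightarrow> x = 0"
  shows "S = V"
proof (rule ccontr)
  assume "S \<noteq> V"
  then have "span S \<subset> span V"
    using assms(1-3) by (simp add: span_eq_iff[THEN iffD2] psubset_eq)
  then obtain x where "x \<noteq> 0" "x \<in> span V" "\<And>y. y \<in> span S \<Longrightarrow> orthogonal x y"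
    using orthogonal_to_subspace_exists_gen by blast
  then show False
    using assms by (simp add: span_eq_iff[THEN iffD2])
qed

lemma eventually_bilinear_injective_on:
  fixes h :: "'a::real_normed_vector \<Rightarrow> 'b::euclidean_space \<Rightarrow> 'c::euclidean_space"
  assumes "bounded_bilinear h" and "subspace S" and inj: "\<forall>x\<in>S. h a x = 0 \<longrightarrow> x = 0"
  shows "\<forall>\<^sub>F b in nhds a. \<forall>x\<in>S. h b x = 0 \<longrightarrow> x = 0"
proof -
  interpret h: bounded_bilinear h by fact
  obtain c where c: "c > 0" "\<And>x. x \<in> S \<Longrightarrow> c * norm x \<le> norm (h a x)"
    using injective_imp_isometric[OF closed_subspace[OF \<open>subspace S\<close>] \<open>subspace S\<close>
        h.bounded_linear_right inj] by (auto simp: mult.commute)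
  obtain K where K: "K > 0" "\<And>y x. norm (h y x) \<le> norm y * norm x * K"
    using h.pos_bounded by blast
  have "x = 0" if b: "dist b a < c / K" and x: "x \<in> S" "h b x = 0" for b x
  proof (rule ccontr)
    assume "x \<noteq> 0"
    have "c * norm x \<le> norm (h (a - b) x)"
      using c(2)[OF x(1)] x(2) by (simp add: h.diff_left)
    also have "\<dots> \<le> (dist b a * K) * norm x"
      using K(2)[of "a - b" x] by (simp add: dist_norm norm_minus_commute mult_ac)
    finally have "c \<le> dist b a * K"
      using \<open>x \<noteq> 0\<close> by simp
    then show False
      using b K(1) by (simp add: field_simps)
  qed
  moreover have "c / K > 0"
    using c(1) K(1) by simp
  ultimately show ?thesis
    unfolding eventually_nhds_metric by blast
qed

subsection \<open>Open mappings between subspaces\<close>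

lemma linear_projection_exists:
  fixes V :: "'a::real_vector set"
  assumes "subspace V"
  obtains p where "linear p" "\<And>x. p x \<in> V" "\<And>x. x \<in> V \<Longrightarrow> p x = x"
  using linear_exists_left_inverse_on[OF linear_ident assms] by (auto simp: image_subset_iff)

lemma open_mapping_surj_derivative:
  fixes f :: "'a::euclidean_space \<Rightarrow> 'b::euclidean_space"
  assumes "continuous_on UNIV f" and deriv: "(f has_derivative f') (at x)" and "surj f'"
    and P: "\<forall>\<^sub>F z in nhds x. P z"
  shows "\<forall>\<^sub>F y in nhds (f x). \<exists>z. P z \<and> y = f z"
proof -
  obtain g where "linear g" "f' \<circ> g = id"
    using linear_surjective_right_inverse[OF has_derivative_linear[OF deriv] \<open>surj f'\<close>] by blast
  moreover have "x \<in> interior {z. P z}"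
    using P by (auto simp: eventually_nhds interior_def)
  ultimately have "f x \<in> interior (f ` {z. P z})"
    using assms by (intro sussmann_open_mapping[of UNIV]) (auto simp: linear_conv_bounded_linear)
  then show ?thesis
    by (auto simp: eventually_nhds interior_def)
qed

lemma open_mapping_plus_projection_complement:
  fixes f :: "'a::euclidean_space \<Rightarrow> 'b::euclidean_space"
  assumes cont: "continuous_on UNIV f" and deriv: "(f has_derivative f') (at x)"
    and "linear q" and range_q: "range q \<subseteq> range f'"
    and P: "\<forall>\<^sub>F z in nhds x. P z"
  shows "\<forall>\<^sub>F y in nhds (f x). \<exists>z w. P z \<and> y = f z + (w - q w)"
proof -
  interpret q: bounded_linear q
    using \<open>linear q\<close> by (simp add: linear_conv_bounded_linear)
  define F where "F = (\<lambda>z. f (fst z) + (snd z - q (snd z)))"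
  define F' where "F' = (\<lambda>z. f' (fst z) + (snd z - q (snd z)))"
  have "continuous_on UNIV F"
    unfolding F_def
    by (intro continuous_intros continuous_on_compose2[OF cont] q.continuous_on) auto
  moreover have "(F has_derivative F') (at (x, 0))"
    unfolding F_def F'_def
    by (intro has_derivative_add has_derivative_compose[of fst _ _ _ f] has_derivative_diff
        q.has_derivative has_derivative_fst has_derivative_snd has_derivative_ident)
      (simp add: deriv)
  moreover have "surj F'"
    unfolding surj_def
  proof
    fix y
    obtain h where "f' h = q y"
      using range_q by (metis imageE rangeI subsetD)
    then show "\<exists>z. y = F' z"
      by (intro exI[of _ "(h, y)"]) (simp add: F'_def)
  qed
  moreover have "\<forall>\<^sub>F z in nhds (x, 0 :: 'b). P (fst z)"
    using eventually_prodI[OF P, of "\<lambda>_. True"] by (simp add: nhds_prod)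
  ultimately have "\<forall>\<^sub>F y in nhds (F (x, 0)). \<exists>z. P (fst z) \<and> y = F z"
    by (rule open_mapping_surj_derivative)
  moreover have "F (x, 0) = f x"
    by (simp add: F_def q.zero)
  ultimately show ?thesis
    by (auto simp: F_def elim!: eventually_mono)
qed

text \<open>
  A projection \<open>q\<close> onto \<open>V\<close> reduces the claim to maps with surjective derivative: for \<open>y \<in> V\<close> the
  summand \<open>w - q w\<close>, which covers a complement of \<open>V\<close>, vanishes.
\<close>

lemma open_mapping_onto_subspace:
  fixes f :: "'a::euclidean_space \<Rightarrow> 'b::euclidean_space"
  assumes cont: "continuous_on UNIV f" and deriv: "(f has_derivative f') (at x)"
    and onto: "range f' = V" and into: "range f \<subseteq> V"
    and P: "\<forall>\<^sub>F z in nhds x. P z"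
  shows "\<forall>\<^sub>F y in nhds (f x). y \<in> V \<longrightarrow> (\<exists>z. P z \<and> y = f z)"
proof -
  have "subspace V"
    using linear_subspace_image[OF has_derivative_linear[OF deriv] subspace_UNIV] onto by simp
  then obtain q where q: "linear q" "\<And>w. q w \<in> V" "\<And>v. v \<in> V \<Longrightarrow> q v = v"
    using linear_projection_exists by metis
  then have "range q \<subseteq> range f'"
    using onto by auto
  from open_mapping_plus_projection_complement[OF cont deriv q(1) this P] show ?thesis
  proof eventually_elim
    case (elim y)
    then obtain z w where zw: "P z" "y = f z + (w - q w)"
      by blast
    show ?case
    proof
      assume "y \<in> V"
      then have "(y - f z) + q w \<in> V"
        using into q(2) by (intro subspace_add subspace_diff \<open>subspace V\<close>) auto
      then show "\<exists>z. P z \<and> y = f z"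
        using q(3) zw by auto
    qed
  qed
qed

lemma open_mapping_between_subspaces:
  fixes f :: "'a::euclidean_space \<Rightarrow> 'b::euclidean_space"
  assumes "subspace U" and cont: "continuous_on UNIV f"
    and deriv: "(f has_derivative f') (at x)" and onto: "f' ` U = V"
    and into: "\<And>u. u \<in> U \<Longrightarrow> f (x + u) \<in> V"
    and P: "\<forall>\<^sub>F z in nhds x. P z"
  shows "\<forall>\<^sub>F y in nhds (f x). y \<in> V \<longrightarrow> (\<exists>u\<in>U. P (x + u) \<and> y = f (x + u))"
proof -
  obtain p where p: "linear p" "\<And>z. p z \<in> U" "\<And>u. u \<in> U \<Longrightarrow> p u = u"
    using linear_projection_exists[OF \<open>subspace U\<close>] by metis
  interpret p: bounded_linear p
    using p(1) by (simp add: linear_conv_bounded_linear)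
  have "continuous_on UNIV (\<lambda>z. f (x + p z))"
    by (intro continuous_intros continuous_on_compose2[OF cont] p.continuous_on) auto
  moreover have "((\<lambda>z. f (x + p z)) has_derivative (\<lambda>z. f' (p z))) (at 0)"
  proof (rule has_derivative_compose[of _ p])
    show "((\<lambda>z. x + p z) has_derivative p) (at 0)"
      by (auto intro!: derivative_eq_intros p.has_derivative)
    show "(f has_derivative f') (at (x + p 0))"
      using deriv by (simp add: p.zero)
  qed
  moreover have "range (\<lambda>z. f' (p z)) = V"
    using onto p(2,3) by (auto simp: image_iff) metis
  moreover have "range (\<lambda>z. f (x + p z)) \<subseteq> V"
    using into p(2) by auto
  moreover have "\<forall>\<^sub>F z in nhds 0. P (x + p z)"
  proof -
    have "((\<lambda>z. x + p z) \<longlongrightarrow> x + p 0) (nhds 0)"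
      by (intro tendsto_intros p.tendsto filterlim_ident)
    then show ?thesis
      using eventually_compose_filterlim[OF P] by (simp add: p.zero)
  qed
  ultimately have "\<forall>\<^sub>F y in nhds (f (x + p 0)). y \<in> V \<longrightarrow> (\<exists>z. P (x + p z) \<and> y = f (x + p z))"
    by (rule open_mapping_onto_subspace)
  then show ?thesis
    using p(2) by (auto simp: p.zero elim!: eventually_mono)
qed

subsection \<open>Matrix algebra and congruence\<close>

lemma bounded_bilinear_matrix_matrix_mult:
  "bounded_bilinear ((**) :: real^'n^'m \<Rightarrow> real^'p^'n \<Rightarrow> real^'p^'m)"
  unfolding bilinear_conv_bounded_bilinear[symmetric] bilinear_def
  by (auto intro!: linearI simp: matrix_matrix_mult_def vec_eq_iff algebra_simps sum.distrib
      sum_distrib_left)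

lemma bounded_linear_transpose:
  "bounded_linear (transpose :: real^'n^'m \<Rightarrow> real^'m^'n)"
  unfolding linear_conv_bounded_linear[symmetric]
  by (auto intro!: linearI simp: transpose_def vec_eq_iff)

definition matrix_congruence :: "real^'m^'n \<Rightarrow> real^'n^'n \<Rightarrow> real^'m^'m" where
  "matrix_congruence C B = transpose C ** B ** C"

lemma matrix_congruence_mat_1 [simp]: "matrix_congruence (mat 1) B = B"
  by (simp add: matrix_congruence_def)

lemma symmetric_mat_matrix_congruence:
  "symmetric_mat B \<Longrightarrow> symmetric_mat (matrix_congruence C B)"
  by (simp add: matrix_congruence_def symmetric_mat_def matrix_transpose_mul matrix_mul_assoc)

lemma continuous_on_matrix_congruence:
  "continuous_on UNIV (\<lambda>z :: (real^'m^'n) \<times> (real^'n^'n). matrix_congruence (fst z) (snd z))"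
  unfolding matrix_congruence_def
  by (intro bounded_bilinear.continuous_on[OF bounded_bilinear_matrix_matrix_mult]
      bounded_linear.continuous_on[OF bounded_linear_transpose] continuous_intros)

lemma has_derivative_matrix_congruence:
  fixes C :: "real^'m^'n" and B :: "real^'n^'n"
  shows "((\<lambda>z. matrix_congruence (fst z) (snd z)) has_derivative
    (\<lambda>z. transpose (fst z) ** B ** C + transpose C ** snd z ** C + transpose C ** B ** fst z))
    (at (C, B))"
proof -
  note mult = bounded_bilinear.FDERIV[OF bounded_bilinear_matrix_matrix_mult]
  note add_left = bounded_bilinear.add_left[OF bounded_bilinear_matrix_matrix_mult]
  have C': "((\<lambda>z :: (real^'m^'n) \<times> (real^'n^'n). fst z) has_derivative fst) (at (C, B))"
    and B': "((\<lambda>z :: (real^'m^'n) \<times> (real^'n^'n). snd z) has_derivative snd) (at (C, B))"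
    by (auto intro!: derivative_eq_intros)
  show ?thesis
    unfolding matrix_congruence_def
    by (rule has_derivative_eq_rhs[OF mult[OF mult[OF
            bounded_linear.has_derivative[OF bounded_linear_transpose C'] B'] C']])
      (simp add: fun_eq_iff add_left add_ac)
qed

definition congruence_tangent :: "real^'n^'n \<Rightarrow> (real^'n^'n) \<times> (real^'n^'n) \<Rightarrow> real^'n^'n" where
  "congruence_tangent A z = transpose (fst z) ** A + snd z + A ** fst z"

lemma has_derivative_matrix_congruence_mat_1:
  "((\<lambda>z. matrix_congruence (fst z) (snd z)) has_derivative congruence_tangent A) (at (mat 1, A))"
  using has_derivative_matrix_congruence[where C = "mat 1" and B = A]
  by (simp add: congruence_tangent_def[abs_def])

lemma symmetric_mat_congruence_tangent:
  assumes "symmetric_mat A" and "symmetric_mat (snd z)"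
  shows "symmetric_mat (congruence_tangent A z)"
  using assms
  by (simp add: congruence_tangent_def symmetric_mat_def matrix_transpose_mul
      linear_simps[OF bounded_linear_transpose] add_ac)

lemma eventually_invertible:
  fixes C :: "real^'n^'n"
  assumes "invertible C"
  shows "\<forall>\<^sub>F D in nhds C. invertible D"
proof -
  have "(det \<longlongrightarrow> det C) (nhds C)"
    unfolding det_def by (intro tendsto_intros filterlim_ident)
  then show ?thesis
    using assms tendsto_imp_eventually_ne by (simp add: invertible_det_nz)
qed

lemma inner_transpose_left:
  fixes X :: "real^'n^'m"
  shows "transpose X \<bullet> Y = X \<bullet> transpose Y"
  by (simp add: inner_vec_def transpose_def) (rule sum.swap)

lemma matrix_matrix_mult_nth: "((A :: 'a::comm_semiring_1^'n^'m) ** B) $ j = A $ j v* B"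
  by (simp add: matrix_matrix_mult_def vector_matrix_mult_def vec_eq_iff mult.commute)

lemma inner_matrix_mult_right:
  fixes A :: "real^'n^'p"
  shows "X \<bullet> (Y ** A) = (X ** transpose A) \<bullet> Y"
proof -
  have "X $ j \<bullet> (Y $ j v* A) = (X $ j v* transpose A) \<bullet> Y $ j" for j
    by (metis dot_lmul_matrix inner_commute vector_transpose_matrix)
  then show ?thesis
    by (simp add: inner_vec_def[of X] inner_vec_def[of _ Y] matrix_matrix_mult_nth)
qed

lemma inner_matrix_mult_left:
  fixes A :: "real^'n^'m"
  shows "X \<bullet> (A ** Y) = (transpose A ** X) \<bullet> Y"
proof -
  have "X \<bullet> (A ** Y) = transpose X \<bullet> (transpose Y ** transpose A)"
    by (simp add: inner_transpose_left matrix_transpose_mul)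
  also have "\<dots> = (transpose X ** A) \<bullet> transpose Y"
    by (simp add: inner_matrix_mult_right)
  also have "\<dots> = (transpose A ** X) \<bullet> Y"
    by (simp add: inner_transpose_left[symmetric] matrix_transpose_mul)
  finally show ?thesis .
qed

subsection \<open>Nullity pairs under congruence\<close>

definition form_kernel :: "(real^'n) set \<Rightarrow> real^'n^'n \<Rightarrow> (real^'n) set" where
  "form_kernel S A = {x\<in>S. \<forall>y\<in>S. y \<bullet> (A *v x) = 0}"

lemma nullity_eq_dim_form_kernel: "nullity A = dim (form_kernel UNIV A)"
proof -
  have "A *v x = 0 \<longleftrightarrow> (\<forall>y. y \<bullet> (A *v x) = 0)" for x
    by (metis inner_eq_zero_iff inner_zero_right)
  then show ?thesis
    by (simp add: nullity_def form_kernel_def)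
qed

lemma nullity_delete_eq_dim_form_kernel:
  fixes A :: "real^'n^'n"
  shows "nullity_delete i A = dim (form_kernel {x. x $ i = 0} A)"
proof -
  have "(\<Sum>k\<in>- {i}. A $ j $ k * x $ k) = (A *v x) $ j" if "x $ i = 0" for x j
    unfolding matrix_vector_mult_def using that by (auto intro!: sum.mono_neutral_left)
  moreover have "(\<forall>j\<in>- {i}. v $ j = 0) \<longleftrightarrow> (\<forall>y. y $ i = 0 \<longrightarrow> y \<bullet> v = 0)" for v :: "real^'n"
  proof
    assume "\<forall>j\<in>- {i}. v $ j = 0"
    then show "\<forall>y. y $ i = 0 \<longrightarrow> y \<bullet> v = 0"
      by (auto simp: inner_vec_def intro!: sum.neutral)
  next
    assume "\<forall>y. y $ i = 0 \<longrightarrow> y \<bullet> v = 0"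
    then have "axis j 1 \<bullet> v = 0" if "j \<noteq> i" for j
      using that by (simp add: axis_def)
    then show "\<forall>j\<in>- {i}. v $ j = 0"
      by (simp add: inner_axis')
  qed
  ultimately have "kernel_delete i A = form_kernel {x. x $ i = 0} A"
    unfolding kernel_delete_def form_kernel_def by (auto cong: conj_cong)
  then show ?thesis
    by (simp add: nullity_delete_def)
qed

lemma dim_form_kernel_congruence:
  fixes A :: "real^'n^'n" and C :: "real^'m^'n"
  assumes "inj ((*v) C)" and image: "(*v) C ` S = T"
  shows "dim (form_kernel S (matrix_congruence C A)) = dim (form_kernel T A)"
proof -
  have "y \<bullet> (matrix_congruence C A *v x) = (C *v y) \<bullet> (A *v (C *v x))" for x y
    unfolding matrix_congruence_def
    by (metis dot_lmul_matrix matrix_vector_mul_assoc transpose_matrix_vector transpose_transpose)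
  then have "(*v) C ` form_kernel S (matrix_congruence C A) = form_kernel T A"
    unfolding form_kernel_def image[symmetric] by auto
  then show ?thesis
    using dim_image_eq[OF matrix_vector_mul_linear inj_on_subset[OF assms(1) subset_UNIV]] by metis
qed

lemma nullity_pair_congruence:
  fixes A C :: "real^'n^'n"
  assumes "invertible C" and row: "C $ i = axis i 1"
  shows "nullity_pair i (matrix_congruence C A) = nullity_pair i A"
proof -
  have inj: "inj ((*v) C)"
    using \<open>invertible C\<close> by (rule inj_matrix_vector_mult)
  then have surj: "range ((*v) C) = UNIV"
    using linear_injective_imp_surjective[OF matrix_vector_mul_linear] by blast
  have "(C *v x) $ i = x $ i" for x
    by (simp add: matrix_vector_mul_component row inner_axis')
  then have "(*v) C ` {x. x $ i = 0} = {x. x $ i = 0}"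
    using surj by (auto simp: image_iff) (metis surjD)
  then show ?thesis
    by (simp add: nullity_pair_def nullity_eq_dim_form_kernel nullity_delete_eq_dim_form_kernel
        dim_form_kernel_congruence[OF inj surj] dim_form_kernel_congruence[OF inj])
qed

subsection \<open>The strong nullity interlacing property\<close>

definition pattern_space :: "'n set set \<Rightarrow> (real^'n^'n) set" where
  "pattern_space E = {B. symmetric_mat B \<and> (\<forall>j k. j \<noteq> k \<and> {j, k} \<notin> E \<longrightarrow> B $ j $ k = 0)}"

definition nonedge_space :: "'n set set \<Rightarrow> (real^'n^'n) set" where
  "nonedge_space E = {X. symmetric_mat X \<and> (\<forall>j k. j = k \<or> {j, k} \<in> E \<longrightarrow> X $ j $ k = 0)}"

definition drop_row :: "'n \<Rightarrow> real^'n^'n \<Rightarrow> real^'n^'n" where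
  "drop_row i A = (\<chi> j. if j = i then 0 else A $ j)"

lemma subspace_symmetric_mat: "subspace {X :: real^'n^'n. symmetric_mat X}"
  by (auto simp: subspace_def symmetric_mat_def transpose_def vec_eq_iff)

lemma subspace_row_eq_0: "subspace {P :: real^'n^'m. P $ i = 0}"
  by (simp add: subspace_def)

lemma subspace_pattern_space: "subspace (pattern_space (E :: 'n::finite set set))"
  by (auto simp: subspace_def pattern_space_def symmetric_mat_def transpose_def vec_eq_iff)

lemma subspace_nonedge_space: "subspace (nonedge_space (E :: 'n::finite set set))"
  by (auto simp: subspace_def nonedge_space_def symmetric_mat_def transpose_def vec_eq_iff)

lemma nonedge_space_eq_orthogonal_pattern_space:
  fixes E :: "'n::finite set set"
  shows "nonedge_space E = {X. symmetric_mat X \<and> (\<forall>B\<in>pattern_space E. X \<bullet> B = 0)}"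
proof (intro equalityI subsetI)
  fix X assume X: "X \<in> nonedge_space E"
  have "X \<bullet> B = 0" if "B \<in> pattern_space E" for B
  proof -
    have "X $ j $ k * B $ j $ k = 0" for j k
      using X that
      by (cases "j = k \<or> {j, k} \<in> E") (auto simp: nonedge_space_def pattern_space_def)
    then show ?thesis
      unfolding inner_vec_def inner_real_def by (intro sum.neutral ballI)
  qed
  then show "X \<in> {X. symmetric_mat X \<and> (\<forall>B\<in>pattern_space E. X \<bullet> B = 0)}"
    using X by (simp add: nonedge_space_def)
next
  fix X assume X: "X \<in> {X. symmetric_mat X \<and> (\<forall>B\<in>pattern_space E. X \<bullet> B = 0)}"
  define B where "B = (\<chi> j k. if j = k \<or> {j, k} \<in> E then X $ j $ k else 0)"
  have "B \<in> pattern_space E"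
    using X by (auto simp: B_def pattern_space_def symmetric_mat_def transpose_def vec_eq_iff
        insert_commute)
  moreover have "X \<bullet> B = B \<bullet> B"
    by (auto simp: B_def inner_vec_def intro!: sum.cong)
  ultimately have "B = 0"
    using X by simp
  then have "X $ j $ k = 0" if "j = k \<or> {j, k} \<in> E" for j k
    using that by (simp add: B_def vec_eq_iff) metis
  then show "X \<in> nonedge_space E"
    using X by (simp add: nonedge_space_def)
qed

lemma bounded_linear_drop_row: "bounded_linear (drop_row (i :: 'n::finite))"
  unfolding linear_conv_bounded_linear[symmetric]
  by (auto intro!: linearI simp: drop_row_def vec_eq_iff)

lemma drop_row_matrix_mult: "drop_row i A ** X = drop_row i (A ** X)"
  by (simp add: drop_row_def matrix_matrix_mult_nth vec_eq_iff)

lemma inner_drop_row_self: "A \<bullet> drop_row i A = drop_row i A \<bullet> drop_row i A"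
  by (auto simp: inner_vec_def drop_row_def intro!: sum.cong)

lemma graph_matrices_subset_pattern_space: "graph_matrices E \<subseteq> pattern_space E"
  by (auto simp: graph_matrices_def pattern_space_def)

lemma eventually_graph_matrices:
  fixes A :: "real^'n^'n"
  assumes "A \<in> graph_matrices E"
  shows "\<forall>\<^sub>F B in nhds A. B \<in> pattern_space E \<longrightarrow> B \<in> graph_matrices E"
proof -
  have "\<forall>\<^sub>F B in nhds A. A $ j $ k \<noteq> 0 \<longrightarrow> B $ j $ k \<noteq> 0" for j k
  proof (cases "A $ j $ k = 0")
    case False
    have "((\<lambda>B. B $ j $ k) \<longlongrightarrow> A $ j $ k) (nhds A)"
      by (intro tendsto_vec_nth filterlim_ident)
    then show ?thesis
      using tendsto_imp_eventually_ne False by simp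
  qed simp
  then have "\<forall>\<^sub>F B in nhds A. \<forall>j k. A $ j $ k \<noteq> 0 \<longrightarrow> B $ j $ k \<noteq> 0"
    by (intro eventually_all_finite)
  then show ?thesis
    by eventually_elim (use assms in \<open>auto simp: graph_matrices_def pattern_space_def\<close>)
qed

lemma SNIP_iff_injective_on_nonedge_space:
  fixes A :: "real^'n^'n"
  assumes "A \<in> graph_matrices E"
  shows "SNIP i A \<longleftrightarrow> (\<forall>X\<in>nonedge_space E. drop_row i A ** X = 0 \<longrightarrow> X = 0)"
proof -
  have sym: "symmetric_mat A" and pat: "j \<noteq> k \<Longrightarrow> A $ j $ k \<noteq> 0 \<longleftrightarrow> {j, k} \<in> E" for j k
    using assms by (auto simp: graph_matrices_def)
  have "X \<in> nonedge_space E \<longleftrightarrow>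
      symmetric_mat X \<and> entrywise_prod A X = 0 \<and> entrywise_prod (mat 1) X = 0" for X
  proof -
    have "entrywise_prod (mat 1) X = 0 \<longleftrightarrow> (\<forall>j. X $ j $ j = 0)"
      by (auto simp: entrywise_prod_def mat_def vec_eq_iff)
    moreover have "entrywise_prod A X = 0 \<longleftrightarrow> (\<forall>j k. {j, k} \<in> E \<longrightarrow> X $ j $ k = 0)"
      if "\<forall>j. X $ j $ j = 0"
      using pat that unfolding entrywise_prod_def vec_eq_iff by simp (metis mult_zero_right)
    ultimately show ?thesis
      unfolding nonedge_space_def by auto
  qed
  moreover have "drop_row i A ** X = 0 \<longleftrightarrow> (\<forall>j k. j \<noteq> i \<longrightarrow> (A ** X) $ j $ k = 0)"
    for X :: "real^'n^'n"
    unfolding drop_row_matrix_mult by (auto simp: drop_row_def vec_eq_iff)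
  ultimately show ?thesis
    using sym unfolding SNIP_def by blast
qed

lemma eventually_SNIP:
  fixes A :: "real^'n^'n"
  assumes "A \<in> graph_matrices E" and "SNIP i A"
  shows "\<forall>\<^sub>F B in nhds A. B \<in> graph_matrices E \<longrightarrow> SNIP i B"
proof -
  have "\<forall>\<^sub>F B in nhds A. \<forall>X\<in>nonedge_space E. drop_row i B ** X = 0 \<longrightarrow> X = 0"
    using assms
    by (intro eventually_bilinear_injective_on subspace_nonedge_space bounded_bilinear.comp1[OF
          bounded_bilinear_matrix_matrix_mult bounded_linear_drop_row])
      (simp add: SNIP_iff_injective_on_nonedge_space)
  then show ?thesis
    by (rule eventually_mono) (simp add: SNIP_iff_injective_on_nonedge_space)
qed

lemma inner_congruence_tangent_row:
  assumes "symmetric_mat A" and "symmetric_mat X"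
  shows "X \<bullet> congruence_tangent A (P, 0) = 2 * ((A ** X) \<bullet> P)"
proof -
  have left: "X \<bullet> (A ** P) = (A ** X) \<bullet> P"
    using assms(1) by (simp add: inner_matrix_mult_left symmetric_mat_def)
  have "X \<bullet> (transpose P ** A) = transpose X \<bullet> transpose (A ** P)"
    using assms by (simp add: matrix_transpose_mul symmetric_mat_def)
  also have "\<dots> = (A ** X) \<bullet> P"
    by (simp add: inner_transpose_left left)
  finally show ?thesis
    by (simp add: congruence_tangent_def inner_add_right left)
qed

lemma symmetric_orthogonal_congruence_tangent_eq_0:
  fixes A :: "real^'n^'n"
  assumes A: "A \<in> graph_matrices E" and "SNIP i A" and X: "symmetric_mat X"
    and orth: "\<And>P Q. P $ i = 0 \<Longrightarrow> Q \<in> pattern_space E \<Longrightarrow> X \<bullet> congruence_tangent A (P, Q) = 0"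
  shows "X = 0"
proof -
  have "X \<bullet> Q = 0" if "Q \<in> pattern_space E" for Q
    using orth[of 0 Q] that
    by (simp add: congruence_tangent_def linear_simps[OF bounded_linear_transpose])
  then have "X \<in> nonedge_space E"
    using X by (simp add: nonedge_space_eq_orthogonal_pattern_space)
  moreover have "drop_row i A ** X = 0"
  proof -
    have "X \<bullet> congruence_tangent A (drop_row i (A ** X), 0) = 0"
      by (intro orth subspace_0[OF subspace_pattern_space]) (simp add: drop_row_def)
    then have "(A ** X) \<bullet> drop_row i (A ** X) = 0"
      using A X by (simp add: inner_congruence_tangent_row graph_matrices_def)
    then show ?thesis
      by (simp add: inner_drop_row_self drop_row_matrix_mult)
  qed
  ultimately show ?thesis
    using assms(1,2) by (simp add: SNIP_iff_injective_on_nonedge_space)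
qed

lemma SNIP_congruence_tangent_onto_symmetric:
  fixes A :: "real^'n^'n"
  assumes A: "A \<in> graph_matrices E" and "SNIP i A"
  shows "congruence_tangent A ` ({P. P $ i = 0} \<times> pattern_space E) = {M. symmetric_mat M}"
    (is "_ ` ?U = _")
proof (rule subspace_eqI_orthogonal)
  have "linear (congruence_tangent A)"
    using has_derivative_matrix_congruence_mat_1 by (rule has_derivative_linear)
  moreover have "subspace ?U"
    by (intro subspace_Times subspace_row_eq_0 subspace_pattern_space)
  ultimately show "subspace (congruence_tangent A ` ?U)"
    by (rule linear_subspace_image)
  show "subspace {M :: real^'n^'n. symmetric_mat M}"
    by (rule subspace_symmetric_mat)
  show "congruence_tangent A ` ?U \<subseteq> {M. symmetric_mat M}"
    using A by (auto simp: graph_matrices_def pattern_space_def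
        intro!: symmetric_mat_congruence_tangent)
next
  fix X
  assume "X \<in> {M. symmetric_mat M}" "\<And>Y. Y \<in> congruence_tangent A ` ?U \<Longrightarrow> orthogonal X Y"
  then show "X = 0"
    by (intro symmetric_orthogonal_congruence_tangent_eq_0[OF assms]) (auto simp: orthogonal_def)
qed

lemma eventually_symmetric_congruent:
  fixes A :: "real^'n^'n"
  assumes A: "A \<in> graph_matrices E" and "SNIP i A"
    and P: "\<forall>\<^sub>F z in nhds (mat 1, A). P z"
  shows "\<forall>\<^sub>F M in nhds A. symmetric_mat M \<longrightarrow>
    (\<exists>C B. C $ i = axis i 1 \<and> B \<in> pattern_space E \<and> P (C, B) \<and> M = matrix_congruence C B)"
proof -
  define U where "U = {R :: real^'n^'n. R $ i = 0} \<times> pattern_space E"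
  define f where "f = (\<lambda>z :: (real^'n^'n) \<times> (real^'n^'n). matrix_congruence (fst z) (snd z))"
  have pattern: "A + snd u \<in> pattern_space E" if "u \<in> U" for u
    using A that graph_matrices_subset_pattern_space
    by (auto simp: U_def intro!: subspace_add subspace_pattern_space)
  have "\<forall>\<^sub>F M in nhds (f (mat 1, A)). M \<in> {M. symmetric_mat M} \<longrightarrow>
      (\<exists>u\<in>U. P ((mat 1, A) + u) \<and> M = f ((mat 1, A) + u))"
  proof (rule open_mapping_between_subspaces[OF _ _ _ _ _ P])
    show "subspace U"
      unfolding U_def by (intro subspace_Times subspace_row_eq_0 subspace_pattern_space)
    show "continuous_on UNIV f"
      unfolding f_def by (rule continuous_on_matrix_congruence)
    show "(f has_derivative congruence_tangent A) (at (mat 1, A))"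
      unfolding f_def by (rule has_derivative_matrix_congruence_mat_1)
    show "congruence_tangent A ` U = {M. symmetric_mat M}"
      unfolding U_def using assms(1,2) by (rule SNIP_congruence_tangent_onto_symmetric)
    show "f ((mat 1, A) + u) \<in> {M. symmetric_mat M}" if "u \<in> U" for u
      using pattern[OF that]
      by (simp add: f_def pattern_space_def symmetric_mat_matrix_congruence)
  qed
  moreover have "f (mat 1, A) = A"
    by (simp add: f_def)
  moreover have "(mat 1 + fst u) $ i = axis i 1" if "u \<in> U" for u
    using that by (auto simp: U_def mat_def axis_def vec_eq_iff)
  ultimately show ?thesis
    using pattern by (force elim!: eventually_mono simp: f_def)
qed

lemma SNIP_eventually_congruent:
  fixes A :: "real^'n^'n"
  assumes "A \<in> graph_matrices E" and "SNIP i A"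
  shows "\<forall>\<^sub>F M in nhds A. symmetric_mat M \<longrightarrow>
    (\<exists>C. \<exists>B\<in>graph_matrices E. invertible C \<and> C $ i = axis i 1 \<and> SNIP i B
      \<and> M = matrix_congruence C B)"
proof -
  have "\<forall>\<^sub>F C in nhds (mat 1 :: real^'n^'n). invertible C"
    by (rule eventually_invertible) (simp add: invertible_det_nz)
  moreover have "\<forall>\<^sub>F B in nhds A. B \<in> pattern_space E \<longrightarrow> B \<in> graph_matrices E \<and> SNIP i B"
    using eventually_graph_matrices[OF assms(1)] eventually_SNIP[OF assms]
    by eventually_elim simp
  ultimately have "\<forall>\<^sub>F z in nhds (mat 1 :: real^'n^'n, A). invertible (fst z) \<and>
      (snd z \<in> pattern_space E \<longrightarrow> snd z \<in> graph_matrices E \<and> SNIP i (snd z))"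
    unfolding nhds_prod by (rule eventually_prodI)
  from eventually_symmetric_congruent[OF assms this] show ?thesis
    by (rule eventually_mono) auto
qed

theorem theorem3p2:
  fixes E :: "'n::finite set set" and i :: 'n and A :: "real^'n^'n"
    and N :: "real^'n^'n \<Rightarrow> real"
  assumes "simple_graph E"
    and "is_norm N"
    and "A \<in> graph_matrices E"
    and "SNIP i A"
  shows "\<exists>\<epsilon>>0. \<forall>M::real^'n^'n. symmetric_mat M \<and> N (M - A) < \<epsilon> \<longrightarrow>
           (\<exists>A'\<in>graph_matrices E. SNIP i A' \<and> nullity_pair i M = nullity_pair i A')"
proof -
  have "\<forall>\<^sub>F M in nhds A. symmetric_mat M \<longrightarrow>
      (\<exists>A'\<in>graph_matrices E. SNIP i A' \<and> nullity_pair i M = nullity_pair i A')"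
    using SNIP_eventually_congruent[OF assms(3,4)]
    by (rule eventually_mono) (metis nullity_pair_congruence)
  then show ?thesis
    unfolding eventually_nhds_is_norm[OF assms(2)] by blast
qed

end
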